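(* Let $f$ and $g$ be entire functions of $n$ complex variables with index-pairs $(m,q)$ and $(m,p)$ respectively, where $m,p,q$ are integers with $m\ge q\ge 1$ and $m\ge p\ge 1$, and let $D$ be a bounded complete $n$-circular domain with center at the origin in $\mathbb{C}^n$. Assume $\lambda_g(m,p)>0$, so that all growth indicators below are defined. Then $$\max\left\{\left[\frac{\overline{\Delta}_{f,D}(m,q)}{\tau_{g,D}(m,p)}\right]^{\frac1{\lambda_g(m,p)}},\left[\frac{\Delta_{f,D}(m,q)}{\overline{\tau}_{g,D}(m,p)}\right]^{\frac1{\lambda_g(m,p)}}\right\}\le \Delta_{g,D}^{(p,q)}(f)\le\left[\frac{\Delta_{f,D}(m,q)}{\overline{\Delta}_{g,D}(m,p)}\right]^{\frac1{\rho_g(m,p)}}.$$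
   Context: All entire functions are transcendental. A bounded complete $n$-circular domain with center at the origin is a nonempty bounded open set $D\subset\mathbb{C}^n$ such that $z\in D$ and $|w_j|\le|z_j|$ for $1\le j\le n$ imply $w\in D$. For $f$ entire on $\mathbb{C}^n$ and $R>0$, $M_{f,D}(R)=\sup\{|f(z)|: z/R\in D\}$; it is strictly increasing and has an inverse $M_{f,D}^{-1}:(|f(0)|,\infty)\to(0,\infty)$ tending to infinity. $M_{g,D}^{-1}M_{f,D}(R)$ means $M_{g,D}^{-1}(M_{f,D}(R))$. $\log^{[0]}x=x$, $\log^{[k]}x=\log(\log^{[k-1]}x)$. Orders: $\rho_f(m,q)=\limsup_{R\to\infty}\frac{\log^{[m]}M_{f,D}(R)}{\log^{[q]}R}$ and $\lambda_f(m,q)$ is the corresponding $\liminf$; these do not depend on $D$. $f$ has index-pair $(1,1)$ if $0<\rho_f(1,1)<\infty$; otherwise $f$ has index-pair $(m,q)\ne(1,1)$, $m\ge q\ge1$, if $\delta_{m-q,0}<\rho_f(m,q)<\infty$ and $\rho_f(m-1,q-1)$ is not a positive real number, where $\delta_{i,j}=1$ if $i=j$ and $0$ otherwise. Types: for $0<\rho_f(m,q)<\infty$, $\Delta_{f,D}(m,q)$ and $\overline{\Delta}_{f,D}(m,q)$ are respectively the $\limsup$ and the $\liminf$ as $R\to\infty$ of $\frac{\log^{[m-1]}M_{f,D}(R)}{[\log^{[q-1]}R]^{\rho_f(m,q)}}$. For $0<\lambda_f(m,q)<\infty$, $\tau_{f,D}(m,q)$ and $\overline{\tau}_{f,D}(m,q)$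 are respectively the $\liminf$ and the $\limsup$ of $\frac{\log^{[m-1]}M_{f,D}(R)}{[\log^{[q-1]}R]^{\lambda_f(m,q)}}$. (Likewise for $g$ with $(m,p)$. Note the bar denotes a $\liminf$ for $\Delta$ and a $\limsup$ for $\tau$.) Relative order: $\rho_g^{(p,q)}(f)=\limsup_{R\to\infty}\frac{\log^{[p]}M_{g,D}^{-1}M_{f,D}(R)}{\log^{[q]}R}$ (independent of $D$). Relative type: for $0<\rho_g^{(p,q)}(f)<\infty$, $\Delta_{g,D}^{(p,q)}(f)=\limsup_{R\to\infty}\frac{\log^{[p-1]}M_{g,D}^{-1}M_{f,D}(R)}{[\log^{[q-1]}R]^{\rho_g^{(p,q)}(f)}}$. Convention: types lie in $[0,\infty]$; $a/0=\infty$ for $a>0$, $a/\infty=0$ for $a<\infty$; indeterminate quotients $0/0$, $\infty/\infty$ are omitted (no assertion is made about them). *)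

theory Defs
  imports "HOL-Analysis.Analysis"
begin

definition entire :: "(complex ^ 'n \<Rightarrow> complex) \<Rightarrow> bool" where
  "entire f \<longleftrightarrow>
     (\<forall>z. \<exists>f'. (f has_derivative f') (at z) \<and> (\<forall>c v. f' (c *s v) = c * f' v))"

definition polynomial_fun :: "(complex ^ 'n \<Rightarrow> complex) \<Rightarrow> bool" where
  "polynomial_fun f \<longleftrightarrow>
     (\<exists>(A :: ('n \<Rightarrow> nat) set) c. finite A \<and>
        (\<forall>z. f z = (\<Sum>\<alpha>\<in>A. c \<alpha> * (\<Prod>i\<in>UNIV. (z $ i) ^ \<alpha> i))))"

definition transcendental_entire :: "(complex ^ 'n \<Rightarrow> complex) \<Rightarrow> bool" where
  "transcendental_entire f \<longleftrightarrow> entire f \<and> \<not> polynomial_fun f"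

definition complete_circular_domain :: "(complex ^ 'n) set \<Rightarrow> bool" where
  "complete_circular_domain D \<longleftrightarrow> D \<noteq> {} \<and> bounded D \<and> open D \<and>
     (\<forall>z\<in>D. \<forall>w. (\<forall>j. norm (w $ j) \<le> norm (z $ j)) \<longrightarrow> w \<in> D)"

definition max_modulus :: "(complex ^ 'n) set \<Rightarrow> (complex ^ 'n \<Rightarrow> complex) \<Rightarrow> real \<Rightarrow> real" where
  "max_modulus D f R = (SUP z\<in>{z. z /\<^sub>R R \<in> D}. norm (f z))"

definition max_modulus_inv :: "(complex ^ 'n) set \<Rightarrow> (complex ^ 'n \<Rightarrow> complex) \<Rightarrow> real \<Rightarrow> real" where
  "max_modulus_inv D f = inv_into {0<..} (max_modulus D f)"

definition iter_log :: "nat \<Rightarrow> real \<Rightarrow> real" where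
  "iter_log k = ln ^^ k"

text \<open>
  The growth orders do not depend on the choice of \<open>D\<close> among complete circular domains;
  they are formed here with the given \<open>D\<close>.
\<close>

definition growth_order :: "(complex ^ 'n) set \<Rightarrow> (complex ^ 'n \<Rightarrow> complex) \<Rightarrow> nat \<Rightarrow> nat \<Rightarrow> ereal" where
  "growth_order D f m q =
     Limsup at_top (\<lambda>R. ereal (iter_log m (max_modulus D f R) / iter_log q R))"

definition lower_growth_order :: "(complex ^ 'n) set \<Rightarrow> (complex ^ 'n \<Rightarrow> complex) \<Rightarrow> nat \<Rightarrow> nat \<Rightarrow> ereal" where
  "lower_growth_order D f m q =
     Liminf at_top (\<lambda>R. ereal (iter_log m (max_modulus D f R) / iter_log q R))"

definition has_index_pair :: "(complex ^ 'n) set \<Rightarrow> (complex ^ 'n \<Rightarrow> complex) \<Rightarrow> nat \<Rightarrow> nat \<Rightarrow> bool" where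
  "has_index_pair D f m q \<longleftrightarrow>
     (if 0 < growth_order D f 1 1 \<and> growth_order D f 1 1 < \<infinity> then m = 1 \<and> q = 1
      else (m, q) \<noteq> (1, 1) \<and> 1 \<le> q \<and> q \<le> m \<and>
        (if m - q = 0 then 1 else 0) < growth_order D f m q \<and> growth_order D f m q < \<infinity> \<and>
        \<not> (0 < growth_order D f (m - 1) (q - 1) \<and> growth_order D f (m - 1) (q - 1) < \<infinity>))"

text \<open>
  The types below are meaningful only when the order occurring in the exponent lies
  strictly between \<open>0\<close> and \<open>\<infinity>\<close>; otherwise \<open>real_of_ereal\<close> returns a dummy exponent.
\<close>

definition upper_type :: "(complex ^ 'n) set \<Rightarrow> (complex ^ 'n \<Rightarrow> complex) \<Rightarrow> nat \<Rightarrow> nat \<Rightarrow> ereal" where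
  "upper_type D f m q =
     Limsup at_top (\<lambda>R. ereal (iter_log (m - 1) (max_modulus D f R) /
       iter_log (q - 1) R powr real_of_ereal (growth_order D f m q)))"

definition lower_type :: "(complex ^ 'n) set \<Rightarrow> (complex ^ 'n \<Rightarrow> complex) \<Rightarrow> nat \<Rightarrow> nat \<Rightarrow> ereal" where
  "lower_type D f m q =
     Liminf at_top (\<lambda>R. ereal (iter_log (m - 1) (max_modulus D f R) /
       iter_log (q - 1) R powr real_of_ereal (growth_order D f m q)))"

text \<open>
  The weak types are normalised by the lower order: \<open>weak_type\<close> is \<open>\<tau>\<close> (a limit inferior),
  \<open>upper_weak_type\<close> is \<open>\<tau>\<close> with a bar (a limit superior).
\<close>

definition weak_type :: "(complex ^ 'n) set \<Rightarrow> (complex ^ 'n \<Rightarrow> complex) \<Rightarrow> nat \<Rightarrow> nat \<Rightarrow> ereal" where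
  "weak_type D f m q =
     Liminf at_top (\<lambda>R. ereal (iter_log (m - 1) (max_modulus D f R) /
       iter_log (q - 1) R powr real_of_ereal (lower_growth_order D f m q)))"

definition upper_weak_type :: "(complex ^ 'n) set \<Rightarrow> (complex ^ 'n \<Rightarrow> complex) \<Rightarrow> nat \<Rightarrow> nat \<Rightarrow> ereal" where
  "upper_weak_type D f m q =
     Limsup at_top (\<lambda>R. ereal (iter_log (m - 1) (max_modulus D f R) /
       iter_log (q - 1) R powr real_of_ereal (lower_growth_order D f m q)))"

text \<open>Relative growth: the reference function \<open>g\<close>, whose maximum modulus is inverted, is the first function argument.\<close>

definition relative_order ::
    "(complex ^ 'n) set \<Rightarrow> (complex ^ 'n \<Rightarrow> complex) \<Rightarrow> (complex ^ 'n \<Rightarrow> complex) \<Rightarrow> nat \<Rightarrow> nat \<Rightarrow> ereal" where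
  "relative_order D g f p q =
     Limsup at_top (\<lambda>R. ereal (iter_log p (max_modulus_inv D g (max_modulus D f R)) / iter_log q R))"

definition relative_type ::
    "(complex ^ 'n) set \<Rightarrow> (complex ^ 'n \<Rightarrow> complex) \<Rightarrow> (complex ^ 'n \<Rightarrow> complex) \<Rightarrow> nat \<Rightarrow> nat \<Rightarrow> ereal" where
  "relative_type D g f p q =
     Limsup at_top (\<lambda>R. ereal (iter_log (p - 1) (max_modulus_inv D g (max_modulus D f R)) /
       iter_log (q - 1) R powr real_of_ereal (relative_order D g f p q)))"

text \<open>Real powers on \<open>[0, \<infinity>]\<close>, for exponents \<open>a > 0\<close>.\<close>

definition epowr :: "ereal \<Rightarrow> real \<Rightarrow> ereal" where
  "epowr x a = (if x = \<infinity> then \<infinity> else ereal (real_of_ereal x powr a))"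

definition determinate_quotient :: "ereal \<Rightarrow> ereal \<Rightarrow> bool" where
  "determinate_quotient a b \<longleftrightarrow> \<not> (a = 0 \<and> b = 0) \<and> \<not> (a = \<infinity> \<and> b = \<infinity>)"

text \<open>
  Division on \<open>ereal\<close> has \<open>a / 0 = \<infinity>\<close> for \<open>a > 0\<close> and \<open>a / \<infinity> = 0\<close> for finite \<open>a\<close>. It gives an
  indeterminate quotient the value \<open>0\<close>, so inside a maximum of non-negative terms such a quotient
  has no effect, i.e. it is omitted.
\<close>

lemma epowr_indeterminate:
  assumes "\<not> determinate_quotient a b"
  shows "epowr (a / b) s = 0"
  using assms by (auto simp: determinate_quotient_def epowr_def divide_ereal_def)

end

theory Submission
  imports Defs "HOL-Complex_Analysis.Conformal_Mappings"
begin

text \<open>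
  Write \<open>M\<^sub>f\<close>, \<open>M\<^sub>g\<close> for the maximum moduli over dilates of \<open>D\<close>, and put \<open>H R = M\<^sub>g\<^sup>-\<^sup>1 (M\<^sub>f R)\<close>,
  \<open>a = log\<^sup>[\<^sup>m\<^sup>-\<^sup>1\<^sup>] M\<^sub>f\<close>, \<open>b = log\<^sup>[\<^sup>m\<^sup>-\<^sup>1\<^sup>] M\<^sub>g\<close>, \<open>u = log\<^sup>[\<^sup>q\<^sup>-\<^sup>1\<^sup>]\<close>, \<open>v = log\<^sup>[\<^sup>p\<^sup>-\<^sup>1\<^sup>]\<close>. Everything follows from the
  identity \<open>b (H R) = a R\<close>, valid for large \<open>R\<close>.

  For any \<open>\<alpha>\<close> and any \<open>\<sigma> > 0\<close> it gives, for large \<open>R\<close>,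
  \<open>(v (H R) / u R powr (\<alpha> / \<sigma>)) powr \<sigma> = (a R / u R powr \<alpha>) / (b r / v r powr \<sigma>)\<close> with \<open>r = H R\<close>.
  The limit superior of such a quotient is at most limsup / liminf unless that is indeterminate, and at least both
  limsup / limsup and liminf / liminf. With \<open>\<alpha> = \<rho>\<^sub>f\<close> these limits are the types of \<open>f\<close> and,
  for \<open>\<sigma> = \<rho>\<^sub>g\<close> or \<open>\<sigma> = \<lambda>\<^sub>g\<close>, the types or weak types of \<open>g\<close> (\<open>relative_type_bounds\<close>).
  The resulting bounds concern the exponents \<open>\<rho>\<^sub>f / \<rho>\<^sub>g\<close> and \<open>\<rho>\<^sub>f / \<lambda>\<^sub>g\<close> of \<open>u\<close>, whereas the
  relative type uses the relative order as its exponent. The same quotient estimates applied to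
  \<open>ln v (H R) / ln u R = (ln a R / ln u R) / (ln b r / ln v r)\<close> show that the relative order lies
  between these two numbers (\<open>relative_order_bounds\<close>). As \<open>u R > 1\<close> eventually, increasing the exponent
  decreases the quotient, and this goes in the required direction for each of the bounds.

  Replacing limits over \<open>r = H R\<close> by limits over all \<open>r\<close> requires that \<open>H\<close> tends to infinity and
  takes all large values. Both hold because the maximum modulus is strictly increasing (by the
  maximum modulus principle on complex lines), continuous, and unbounded (by Liouville's
  theorem).
\<close>

section \<open>Limits superior and inferior of quotients\<close>

lemma frequently_less_of_less_Limsup:
  fixes X :: "'a \<Rightarrow> ereal"
  assumes "c < Limsup F X"
  shows "\<exists>\<^sub>F x in F. c < X x"
proof (rule ccontr)
  assume "\<not> (\<exists>\<^sub>F x in F. c < X x)"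
  then have "\<forall>\<^sub>F x in F. X x \<le> c"
    by (simp add: not_frequently not_less)
  then show False
    using Limsup_bounded[of X c F] assms by simp
qed

lemma frequently_less_of_Liminf_less:
  fixes X :: "'a \<Rightarrow> ereal"
  assumes "Liminf F X < c"
  shows "\<exists>\<^sub>F x in F. X x < c"
proof (rule ccontr)
  assume "\<not> (\<exists>\<^sub>F x in F. X x < c)"
  then have "\<forall>\<^sub>F x in F. c \<le> X x"
    by (simp add: not_frequently not_less)
  then show False
    using Liminf_bounded[of c X F] assms by simp
qed

lemma le_Limsup_of_frequently:
  fixes X :: "'a \<Rightarrow> ereal"
  assumes "\<exists>\<^sub>F x in F. c \<le> X x"
  shows "c \<le> Limsup F X"
proof (rule ccontr)
  assume "\<not> c \<le> Limsup F X"
  then have "\<forall>\<^sub>F x in F. X x < c"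
    by (simp add: Limsup_lessD)
  then show False
    using assms by (simp add: frequently_def not_le)
qed

lemma Limsup_compose_filtermap:
  fixes X :: "'b \<Rightarrow> ereal"
  shows "Limsup F (\<lambda>x. X (h x)) = Limsup (filtermap h F) X"
proof (rule antisym)
  show "Limsup (filtermap h F) X \<le> Limsup F (\<lambda>x. X (h x))"
    unfolding Limsup_le_iff eventually_filtermap by (auto dest: Limsup_lessD)
qed (rule Limsup_filtermap_ge)

lemma Liminf_compose_filtermap:
  fixes X :: "'b \<Rightarrow> ereal"
  shows "Liminf F (\<lambda>x. X (h x)) = Liminf (filtermap h F) X"
proof (rule antisym)
  show "Liminf F (\<lambda>x. X (h x)) \<le> Liminf (filtermap h F) X"
    unfolding le_Liminf_iff eventually_filtermap by (auto dest: less_LiminfD)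
qed (rule Liminf_filtermap_le)

text \<open>
  A strict bound on a quotient of extended reals is witnessed by a real number separating numerator
  and denominator. These two facts absorb all the case distinctions about zero and infinite
  denominators.
\<close>

lemma ereal_less_divide_obtain:
  fixes X Y :: ereal
  assumes "0 \<le> X" "0 \<le> Y" "0 < c" "ereal c < X / Y"
  obtains y where "0 < y" "Y < ereal y" "ereal (c * y) < X"
proof (cases Y)
  case (real r)
  have "ereal (c * r) < X"
  proof (cases "r = 0")
    case True
    then have "X \<noteq> 0" using assms real by auto
    then show ?thesis using assms True by (simp add: zero_ereal_def)
  next
    case False
    then show ?thesis using assms real
      by (simp add: ereal_less_divide_pos mult.commute)
  qed
  then obtain z where z: "ereal (c * r) < ereal z" "ereal z < X"
    using ereal_dense2 by blast
  have r: "r < z / c" using z(1) assms(3) by (simp add: field_simps)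
  show ?thesis
    by (rule that[of "z / c"]) (use r real assms z in auto)
qed (use assms in auto)

lemma ereal_divide_less_obtain:
  fixes X Y :: ereal
  assumes "0 \<le> X" "0 \<le> Y" "0 < c" "X / Y < ereal c" "determinate_quotient X Y"
  obtains y where "0 < y" "ereal y < Y" "X < ereal (c * y)"
proof (cases Y)
  case (real r)
  have "r \<noteq> 0"
    using assms real
    by (auto simp: determinate_quotient_def divide_ereal_def zero_ereal_def[symmetric] split: if_splits)
  then have r: "r > 0" using assms real by auto
  then have "X < ereal (c * r)"
    using assms real by (simp add: ereal_divide_less_pos mult.commute)
  then obtain z where z: "X < ereal z" "ereal z < ereal (c * r)"
    using ereal_dense2 by blast
  have "0 < z" using z(1) assms(1) by (meson ereal_less(2) le_less_trans)
  then show ?thesis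
    by (intro that[of "z / c"]) (use real assms z in \<open>auto simp: field_simps\<close>)
next
  case PInf
  then obtain x where x: "X = ereal x" "0 \<le> x"
    using assms by (cases X) (auto simp: determinate_quotient_def)
  show ?thesis
    by (rule that[of "x / c + 1"]) (use x PInf assms in \<open>auto simp: field_simps add_pos_nonneg\<close>)
qed (use assms in auto)

context
  fixes F :: "'a filter" and \<phi> \<psi> :: "'a \<Rightarrow> real"
  assumes F: "F \<noteq> bot"
    and \<phi>: "\<forall>\<^sub>F x in F. 0 \<le> \<phi> x"
    and \<psi>: "\<forall>\<^sub>F x in F. 0 < \<psi> x"
begin

lemma quotient_limits_nonneg:
  "0 \<le> Limsup F (\<lambda>x. ereal (\<phi> x))" "0 \<le> Liminf F (\<lambda>x. ereal (\<phi> x))"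
  "0 \<le> Limsup F (\<lambda>x. ereal (\<psi> x))" "0 \<le> Liminf F (\<lambda>x. ereal (\<psi> x))"
  "0 \<le> Limsup F (\<lambda>x. ereal (\<phi> x / \<psi> x))"
proof -
  show "0 \<le> Limsup F (\<lambda>x. ereal (\<phi> x))" "0 \<le> Liminf F (\<lambda>x. ereal (\<phi> x))"
    by (intro le_Limsup Liminf_bounded F; use \<phi> in simp)+
  show "0 \<le> Limsup F (\<lambda>x. ereal (\<psi> x))" "0 \<le> Liminf F (\<lambda>x. ereal (\<psi> x))"
    by (intro le_Limsup Liminf_bounded F; use \<psi> in \<open>auto elim: eventually_mono\<close>)+
  show "0 \<le> Limsup F (\<lambda>x. ereal (\<phi> x / \<psi> x))"
    using \<phi> \<psi> by (intro le_Limsup F) (auto elim: eventually_elim2)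
qed

lemma Limsup_quotient_le:
  assumes det: "determinate_quotient (Limsup F (\<lambda>x. ereal (\<phi> x))) (Liminf F (\<lambda>x. ereal (\<psi> x)))"
    (is "determinate_quotient ?X ?Y")
  shows "Limsup F (\<lambda>x. ereal (\<phi> x / \<psi> x)) \<le> ?X / ?Y" (is "?L \<le> _")
proof (rule ccontr)
  assume "\<not> ?L \<le> ?X / ?Y"
  then obtain c where c: "?X / ?Y < ereal c" "ereal c < ?L"
    using ereal_dense2 by (meson not_le)
  have "0 \<le> ?X / ?Y" using quotient_limits_nonneg by (cases "?Y = 0") auto
  then have c0: "0 < c" using c(1) by (meson ereal_less(2) le_less_trans)
  obtain y where y: "0 < y" "ereal y < ?Y" "?X < ereal (c * y)"
    using ereal_divide_less_obtain[OF quotient_limits_nonneg(1,4) c0 c(1) det] .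
  have "\<forall>\<^sub>F x in F. ereal (\<phi> x / \<psi> x) \<le> ereal c"
    using Limsup_lessD[OF y(3)] less_LiminfD[OF y(2)] \<psi>
  proof eventually_elim
    case (elim x)
    then have "c * y < c * \<psi> x" using c0 by simp
    then have "\<phi> x < c * \<psi> x" using elim by simp
    then show ?case using elim by (simp add: divide_le_eq)
  qed
  from Limsup_bounded[OF this] c(2) show False by simp
qed

text \<open>
  For a lower bound it suffices that one of the two limits is attained along some sequence
  only, provided that the other estimate holds eventually: the two can then be combined
  along that sequence. This gives two variants.
\<close>

lemma quotient_le_Limsup:
  "Limsup F (\<lambda>x. ereal (\<phi> x)) / Limsup F (\<lambda>x. ereal (\<psi> x)) \<le> Limsup F (\<lambda>x. ereal (\<phi> x / \<psi> x))"
  "Liminf F (\<lambda>x. ereal (\<phi> x)) / Liminf F (\<lambda>x. ereal (\<psi> x)) \<le> Limsup F (\<lambda>x. ereal (\<phi> x / \<psi> x))"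
proof -
  let ?L = "Limsup F (\<lambda>x. ereal (\<phi> x / \<psi> x))"
  have *: "X / Y \<le> ?L" if nn: "0 \<le> X" "0 \<le> Y"
    and fr: "\<And>x y. ereal x < X \<Longrightarrow> Y < ereal y \<Longrightarrow> \<exists>\<^sub>F t in F. x < \<phi> t \<and> \<psi> t < y" for X Y
  proof (rule ccontr)
    assume "\<not> X / Y \<le> ?L"
    then obtain c where c: "?L < ereal c" "ereal c < X / Y"
      using ereal_dense2 by (meson not_le)
    have c0: "0 < c" using c(1) quotient_limits_nonneg(5) by (meson ereal_less(2) le_less_trans)
    obtain y where y: "0 < y" "Y < ereal y" "ereal (c * y) < X"
      using ereal_less_divide_obtain[OF nn c0 c(2)] .
    have "\<exists>\<^sub>F t in F. (c * y < \<phi> t \<and> \<psi> t < y) \<and> 0 < \<psi> t"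
      by (rule frequently_eventually_conj[OF fr[OF y(3,2)] \<psi>, THEN frequently_elim1]) auto
    then have "\<exists>\<^sub>F t in F. ereal c \<le> ereal (\<phi> t / \<psi> t)"
    proof (rule frequently_elim1)
      fix t assume t: "(c * y < \<phi> t \<and> \<psi> t < y) \<and> 0 < \<psi> t"
      then have "c * \<psi> t < c * y" using c0 by simp
      then show "ereal c \<le> ereal (\<phi> t / \<psi> t)" using t by (simp add: le_divide_eq)
    qed
    from le_Limsup_of_frequently[OF this] c(1) show False by simp
  qed
  show "Limsup F (\<lambda>x. ereal (\<phi> x)) / Limsup F (\<lambda>x. ereal (\<psi> x)) \<le> ?L"
  proof (rule *[OF quotient_limits_nonneg(1,3)])
    fix x y assume "ereal x < Limsup F (\<lambda>x. ereal (\<phi> x))" "Limsup F (\<lambda>x. ereal (\<psi> x)) < ereal y"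
    from frequently_eventually_conj[OF frequently_less_of_less_Limsup[OF this(1)] Limsup_lessD[OF this(2)]]
    show "\<exists>\<^sub>F t in F. x < \<phi> t \<and> \<psi> t < y" by (rule frequently_elim1) auto
  qed
  show "Liminf F (\<lambda>x. ereal (\<phi> x)) / Liminf F (\<lambda>x. ereal (\<psi> x)) \<le> ?L"
  proof (rule *[OF quotient_limits_nonneg(2,4)])
    fix x y assume "ereal x < Liminf F (\<lambda>x. ereal (\<phi> x))" "Liminf F (\<lambda>x. ereal (\<psi> x)) < ereal y"
    from frequently_eventually_conj[OF frequently_less_of_Liminf_less[OF this(2)] less_LiminfD[OF this(1)]]
    show "\<exists>\<^sub>F t in F. x < \<phi> t \<and> \<psi> t < y" by (rule frequently_elim1) auto
  qed
qed

end

lemma epowr_le_Limsup: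
  fixes w :: "'a \<Rightarrow> real"
  assumes F: "F \<noteq> bot" and w: "\<forall>\<^sub>F x in F. 0 \<le> w x" and s: "0 < s"
    and X: "0 \<le> X" "X \<le> Limsup F (\<lambda>x. ereal (w x powr s))"
  shows "epowr X (1 / s) \<le> Limsup F (\<lambda>x. ereal (w x))"
proof (rule ccontr)
  let ?L = "Limsup F (\<lambda>x. ereal (w x))"
  assume "\<not> ?thesis"
  then obtain c where c: "?L < ereal c" "ereal c < epowr X (1 / s)"
    using ereal_dense2 by (meson not_le)
  have "0 \<le> ?L" using w by (intro le_Limsup F) auto
  then have c0: "0 < c" using c(1) by (meson ereal_less(2) le_less_trans)
  have "ereal (c powr s) < X"
  proof (cases X)
    case (real x)
    then have x: "0 \<le> x" "c < x powr (1 / s)" using X c by (auto simp: epowr_def)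
    then have "c powr s < (x powr (1 / s)) powr s" using c0 s by (intro powr_less_mono2) auto
    also have "\<dots> = x" using s x by (simp add: powr_powr)
    finally show ?thesis using real by simp
  qed (use X in auto)
  with X have "\<exists>\<^sub>F x in F. ereal (c powr s) < ereal (w x powr s)"
    by (intro frequently_less_of_less_Limsup) auto
  from frequently_eventually_conj[OF this w] have "\<exists>\<^sub>F x in F. ereal c \<le> ereal (w x)"
  proof (rule frequently_elim1)
    fix x assume x: "0 \<le> w x \<and> ereal (c powr s) < ereal (w x powr s)"
    show "ereal c \<le> ereal (w x)"
    proof (rule ccontr)
      assume "\<not> ?thesis"
      then have "w x powr s \<le> c powr s" using x s by (intro powr_mono2) auto
      then show False using x by simp
    qed
  qed
  from le_Limsup_of_frequently[OF this] c(1) show False by simp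
qed

lemma Limsup_le_epowr:
  fixes w :: "'a \<Rightarrow> real"
  assumes F: "F \<noteq> bot" and w: "\<forall>\<^sub>F x in F. 0 \<le> w x" and s: "0 < s"
    and X: "0 \<le> X" "Limsup F (\<lambda>x. ereal (w x powr s)) \<le> X"
  shows "Limsup F (\<lambda>x. ereal (w x)) \<le> epowr X (1 / s)"
proof (rule ccontr)
  let ?L = "Limsup F (\<lambda>x. ereal (w x))"
  assume "\<not> ?thesis"
  then obtain c where c: "epowr X (1 / s) < ereal c" "ereal c < ?L"
    using ereal_dense2 by (meson not_le)
  then obtain x where x: "X = ereal x" "0 \<le> x"
    using X by (cases X) (auto simp: epowr_def)
  have c1: "x powr (1 / s) < c" using c x by (auto simp: epowr_def)
  then have c0: "0 < c" by (meson powr_ge_zero le_less_trans)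
  have "x = (x powr (1 / s)) powr s" using s x by (simp add: powr_powr)
  also have "\<dots> < c powr s" using c1 s by (intro powr_less_mono2) auto
  finally have "Limsup F (\<lambda>x. ereal (w x powr s)) < ereal (c powr s)"
    using X x by (auto intro: le_less_trans)
  from Limsup_lessD[OF this] w have "\<forall>\<^sub>F x in F. ereal (w x) \<le> ereal c"
  proof eventually_elim
    case (elim x)
    show ?case
    proof (rule ccontr)
      assume "\<not> ?thesis"
      then have "c powr s \<le> w x powr s" using c0 s by (intro powr_mono2) auto
      then show False using elim by simp
    qed
  qed
  from Limsup_bounded[OF this] c(2) show False by simp
qed

section \<open>Comparing two growth scales through a change of variable\<close>

lemma filtermap_eq_of_right_inverse:
  assumes H: "filterlim H G F" and K: "filterlim K F G" and HK: "\<forall>\<^sub>F y in G. H (K y) = y"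
  shows "filtermap H F = G"
proof (rule antisym)
  show "filtermap H F \<le> G" using H by (simp add: filterlim_def)
  show "G \<le> filtermap H F"
    unfolding le_filter_def eventually_filtermap
  proof (intro allI impI)
    fix P assume "\<forall>\<^sub>F x in F. P (H x)"
    from eventually_compose_filterlim[OF this K] have "\<forall>\<^sub>F y in G. P (H (K y))" .
    with HK show "\<forall>\<^sub>F y in G. P y" by eventually_elim simp
  qed
qed

text \<open>
  Below, \<open>u\<close> and \<open>v\<close> are iterated logarithms of the radii, \<open>a\<close> and \<open>b\<close> those of the maximum moduli
  of the two functions, and \<open>H\<close> sends a radius for the first function to the radius at which the
  second one has the same maximum modulus. The hypothesis on \<open>filtermap H\<close> makes limits superior
  and inferior insensitive to the substitution \<open>H\<close>.
\<close>

locale growth_comparison =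
  fixes a b u v H :: "real \<Rightarrow> real"
  assumes a: "filterlim a at_top at_top" and b: "filterlim b at_top at_top"
    and u: "filterlim u at_top at_top" and v: "filterlim v at_top at_top"
    and H: "filtermap H at_top = at_top"
    and bH: "\<forall>\<^sub>F R in at_top. b (H R) = a R"
begin

lemma vH: "filterlim (\<lambda>R. v (H R)) at_top at_top"
  using filterlim_compose[OF v, of H at_top] H by (simp add: filterlim_def)

lemma Limsup_H: "Limsup at_top (\<lambda>R. ereal (h (H R))) = Limsup at_top (\<lambda>r. ereal (h r))"
  using Limsup_compose_filtermap[of at_top "\<lambda>r. ereal (h r)" H] H by simp

lemma Liminf_H: "Liminf at_top (\<lambda>R. ereal (h (H R))) = Liminf at_top (\<lambda>r. ereal (h r))"
  using Liminf_compose_filtermap[of at_top "\<lambda>r. ereal (h r)" H] H by simp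

lemma eventually_large: "\<forall>\<^sub>F R in at_top. 1 < a R \<and> 1 < u R \<and> 1 < v (H R) \<and> b (H R) = a R"
  using a u vH bH unfolding filterlim_at_top_dense by (auto intro!: eventually_conj)

lemma relative_order_bounds:
  fixes \<rho>\<^sub>a \<rho>\<^sub>b l\<^sub>b :: real
  assumes \<rho>a: "Limsup at_top (\<lambda>R. ereal (ln (a R) / ln (u R))) = ereal \<rho>\<^sub>a"
    and \<rho>b: "Limsup at_top (\<lambda>r. ereal (ln (b r) / ln (v r))) = ereal \<rho>\<^sub>b"
    and lb: "Liminf at_top (\<lambda>r. ereal (ln (b r) / ln (v r))) = ereal l\<^sub>b"
    and pos: "0 < \<rho>\<^sub>b" "0 < l\<^sub>b"
  shows "ereal (\<rho>\<^sub>a / \<rho>\<^sub>b) \<le> Limsup at_top (\<lambda>R. ereal (ln (v (H R)) / ln (u R)))"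
    and "Limsup at_top (\<lambda>R. ereal (ln (v (H R)) / ln (u R))) \<le> ereal (\<rho>\<^sub>a / l\<^sub>b)"
proof -
  let ?\<phi> = "\<lambda>R. ln (a R) / ln (u R)" and ?\<psi> = "\<lambda>R. ln (b (H R)) / ln (v (H R))"
  have \<phi>: "\<forall>\<^sub>F R in at_top. 0 \<le> ?\<phi> R" and \<psi>: "\<forall>\<^sub>F R in at_top. 0 < ?\<psi> R"
    using eventually_large by (auto elim!: eventually_mono)
  have eq: "Limsup at_top (\<lambda>R. ereal (ln (v (H R)) / ln (u R))) = Limsup at_top (\<lambda>R. ereal (?\<phi> R / ?\<psi> R))"
    by (rule Limsup_eq, use eventually_large in eventually_elim) auto
  note lims = \<rho>a Limsup_H[of "\<lambda>r. ln (b r) / ln (v r)"] Liminf_H[of "\<lambda>r. ln (b r) / ln (v r)"] \<rho>b lb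
  show "ereal (\<rho>\<^sub>a / \<rho>\<^sub>b) \<le> Limsup at_top (\<lambda>R. ereal (ln (v (H R)) / ln (u R)))"
    unfolding eq using quotient_le_Limsup(1)[OF _ \<phi> \<psi>] pos lims by simp
  show "Limsup at_top (\<lambda>R. ereal (ln (v (H R)) / ln (u R))) \<le> ereal (\<rho>\<^sub>a / l\<^sub>b)"
    unfolding eq using Limsup_quotient_le[OF _ \<phi> \<psi>] pos lims
    by (simp add: determinate_quotient_def)
qed

text \<open>
  Since \<open>b (H R) = a R\<close> eventually, raising \<open>v (H R) / u R powr (\<alpha> / \<sigma>)\<close> to the power \<open>\<sigma>\<close> gives the quotient of
  \<open>a R / u R powr \<alpha>\<close> by the value of \<open>b / v powr \<sigma>\<close> at \<open>H R\<close>, so the bounds for quotients apply.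
\<close>

lemma powr_quotient_eq:
  assumes "0 < \<sigma>"
  shows "\<forall>\<^sub>F R in at_top. ereal ((v (H R) / u R powr (\<alpha> / \<sigma>)) powr \<sigma>) =
      ereal ((a R / u R powr \<alpha>) / (b (H R) / v (H R) powr \<sigma>))"
  using eventually_large by eventually_elim (use assms in \<open>simp add: powr_divide powr_powr\<close>)

lemma relative_type_bounds:
  fixes \<alpha> \<sigma> :: real
  assumes \<sigma>: "0 < \<sigma>"
  defines "L \<equiv> Limsup at_top (\<lambda>R. ereal (v (H R) / u R powr (\<alpha> / \<sigma>)))"
    and "A \<equiv> Limsup at_top (\<lambda>R. ereal (a R / u R powr \<alpha>))"
    and "A' \<equiv> Liminf at_top (\<lambda>R. ereal (a R / u R powr \<alpha>))"
    and "B \<equiv> Limsup at_top (\<lambda>r. ereal (b r / v r powr \<sigma>))"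
    and "B' \<equiv> Liminf at_top (\<lambda>r. ereal (b r / v r powr \<sigma>))"
  shows "determinate_quotient A B' \<Longrightarrow> L \<le> epowr (A / B') (1 / \<sigma>)"
    and "epowr (A / B) (1 / \<sigma>) \<le> L"
    and "epowr (A' / B') (1 / \<sigma>) \<le> L"
proof -
  let ?\<phi> = "\<lambda>R. a R / u R powr \<alpha>" and ?\<psi> = "\<lambda>R. b (H R) / v (H R) powr \<sigma>"
  have \<phi>: "\<forall>\<^sub>F R in at_top. 0 \<le> ?\<phi> R" and \<psi>: "\<forall>\<^sub>F R in at_top. 0 < ?\<psi> R"
    and w: "\<forall>\<^sub>F R in at_top. 0 \<le> v (H R) / u R powr (\<alpha> / \<sigma>)"
    using eventually_large by (auto elim!: eventually_mono)
  note nt = trivial_limit_at_top_linorder[where 'a = real]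
  note eq = Limsup_eq[OF powr_quotient_eq[OF \<sigma>, of \<alpha>]]
  note H_lims = Limsup_H[of "\<lambda>r. b r / v r powr \<sigma>"] Liminf_H[of "\<lambda>r. b r / v r powr \<sigma>"]
  have nn: "0 \<le> A" "0 \<le> A'" "0 \<le> B" "0 \<le> B'"
    using quotient_limits_nonneg[OF nt \<phi> \<psi>] unfolding H_lims A_def A'_def B_def B'_def by auto
  have nn_divide: "0 \<le> X / Y" if "0 \<le> X" "0 \<le> Y" for X Y :: ereal
    using that by (cases "Y = 0") auto
  show "L \<le> epowr (A / B') (1 / \<sigma>)" if "determinate_quotient A B'"
    unfolding L_def
    by (rule Limsup_le_epowr[OF nt w \<sigma> nn_divide])
      (use that nn Limsup_quotient_le[OF nt \<phi> \<psi>] in \<open>auto simp: eq H_lims A_def B'_def\<close>)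
  show "epowr (A / B) (1 / \<sigma>) \<le> L"
    unfolding L_def
    by (rule epowr_le_Limsup[OF nt w \<sigma> nn_divide])
      (use nn quotient_le_Limsup(1)[OF nt \<phi> \<psi>] in \<open>auto simp: eq H_lims A_def B_def\<close>)
  show "epowr (A' / B') (1 / \<sigma>) \<le> L"
    unfolding L_def
    by (rule epowr_le_Limsup[OF nt w \<sigma> nn_divide])
      (use nn quotient_le_Limsup(2)[OF nt \<phi> \<psi>] in \<open>auto simp: eq H_lims A'_def B'_def\<close>)
qed

lemma type_antimono:
  assumes "\<kappa> \<le> \<kappa>'"
  shows "Limsup at_top (\<lambda>R. ereal (v (H R) / u R powr \<kappa>')) \<le> Limsup at_top (\<lambda>R. ereal (v (H R) / u R powr \<kappa>))"
  by (rule Limsup_mono, use eventually_large in eventually_elim)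
    (use assms in \<open>auto intro!: divide_left_mono powr_mono\<close>)

end

section \<open>The maximum modulus of an entire function\<close>

text \<open>
  Restricting to complex lines through the origin reduces the function theory needed here to one
  variable.
\<close>

lemma entire_slice_holomorphic:
  fixes f :: "complex ^ 'n \<Rightarrow> complex"
  assumes "entire f"
  shows "(\<lambda>c. f (c *s w)) holomorphic_on S"
proof -
  have "(\<lambda>c. f (c *s w)) field_differentiable (at c)" for c
  proof -
    obtain f' where f': "(f has_derivative f') (at (c *s w))" "\<And>c v. f' (c *s v) = c * f' v"
      using assms unfolding entire_def by blast
    have "bounded_linear (\<lambda>c. c *s w)"
      by (intro linear_conv_bounded_linear[THEN iffD1] linearI)
        (simp_all add: vec_eq_iff algebra_simps)
    then have "((\<lambda>c. c *s w) has_derivative (\<lambda>c. c *s w)) (at c)"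
      by (rule bounded_linear_imp_has_derivative)
    from has_derivative_compose[OF this f'(1)] have "((\<lambda>c. f (c *s w)) has_derivative (\<lambda>h. h * f' w)) (at c)"
      by (simp add: f'(2))
    then have "((\<lambda>c. f (c *s w)) has_field_derivative f' w) (at c)"
      by (simp add: has_field_derivative_def mult.commute[of "f' w"] mult_commute_abs)
    then show ?thesis by (auto simp: field_differentiable_def)
  qed
  then show ?thesis
    by (auto simp: holomorphic_on_def intro: field_differentiable_at_within)
qed

lemma entire_continuous_on:
  assumes "entire f"
  shows "continuous_on S f"
proof (rule continuous_at_imp_continuous_on, intro ballI)
  fix z
  obtain f' where "(f has_derivative f') (at z)" using assms unfolding entire_def by blast
  then show "isCont f z" by (rule has_derivative_continuous)
qed

lemma transcendental_entire_nonconstant: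
  assumes "transcendental_entire f"
  shows "\<exists>z. f z \<noteq> f 0"
proof (rule ccontr)
  assume "\<not> (\<exists>z. f z \<noteq> f 0)"
  then have "polynomial_fun f"
    unfolding polynomial_fun_def
    by (intro exI[of _ "{\<lambda>_. 0}"] exI[of _ "\<lambda>_. f 0"]) auto
  then show False using assms by (simp add: transcendental_entire_def)
qed

lemma scaleR_eq_vector_scalar_mult: "r *\<^sub>R z = complex_of_real r *s z" for z :: "complex ^ 'n"
  unfolding vec_eq_iff by (simp add: scaleR_conv_of_real[where 'a = complex])

locale nonconstant_entire_on_domain =
  fixes f :: "complex ^ 'n \<Rightarrow> complex" and D :: "(complex ^ 'n) set"
  assumes entire: "entire f" and nonconstant: "\<exists>z. f z \<noteq> f 0"
    and domain: "complete_circular_domain D"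
begin

lemma open_domain: "open D" and bounded_domain: "bounded D" and domain_nonempty: "D \<noteq> {}"
  using domain by (auto simp: complete_circular_domain_def)

lemma domain_mono: "z \<in> D \<Longrightarrow> (\<And>j. norm (w $ j) \<le> norm (z $ j)) \<Longrightarrow> w \<in> D"
  using domain unfolding complete_circular_domain_def by blast

lemma zero_in_domain: "0 \<in> D"
  using domain_nonempty domain_mono by force

lemma bdd_above_image: "bdd_above ((\<lambda>z. norm (f (R *\<^sub>R z))) ` D)"
proof -
  have "continuous_on (closure D) (\<lambda>z. norm (f (R *\<^sub>R z)))"
    by (intro continuous_intros continuous_on_compose2[OF entire_continuous_on[OF entire, of UNIV]]) auto
  then have "compact ((\<lambda>z. norm (f (R *\<^sub>R z))) ` closure D)"
    using bounded_domain by (intro compact_continuous_image) (auto simp: compact_closure)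
  then have "bdd_above ((\<lambda>z. norm (f (R *\<^sub>R z))) ` closure D)"
    by (intro bounded_imp_bdd_above compact_imp_bounded)
  then show ?thesis
    by (rule bdd_above_mono) (use closure_subset in auto)
qed

lemma max_modulus_eq:
  assumes "0 < R"
  shows "max_modulus D f R = (SUP z\<in>D. norm (f (R *\<^sub>R z)))"
proof -
  have "{z. z /\<^sub>R R \<in> D} = (\<lambda>z. R *\<^sub>R z) ` D"
  proof (intro equalityI subsetI)
    fix z assume "z \<in> {z. z /\<^sub>R R \<in> D}"
    then show "z \<in> (\<lambda>z. R *\<^sub>R z) ` D"
      using assms by (intro image_eqI[of _ _ "z /\<^sub>R R"]) auto
  qed (use assms in auto)
  then show ?thesis by (simp add: max_modulus_def image_image)
qed

lemma norm_le_max_modulus: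
  assumes "0 < R" "z \<in> D"
  shows "norm (f (R *\<^sub>R z)) \<le> max_modulus D f R"
  unfolding max_modulus_eq[OF assms(1)] using assms(2) bdd_above_image by (rule cSUP_upper)

lemma max_modulus_le:
  assumes "0 < R" "\<And>z. z \<in> D \<Longrightarrow> norm (f (R *\<^sub>R z)) \<le> B"
  shows "max_modulus D f R \<le> B"
  unfolding max_modulus_eq[OF assms(1)] using domain_nonempty assms(2) by (rule cSUP_least)

text \<open>
  If the maximum modulus were attained at \<open>R *\<^sub>R z\<^sub>0\<close>, then \<open>f\<close> would be constant on the complex line
  through that point, so the maximum would also be attained at the origin. As the
  origin lies on every complex line that remains, \<open>f\<close> would be constant on each of them, with
  value \<open>f 0\<close>.
\<close>

lemma norm_less_max_modulus:
  assumes R: "0 < R" and z0: "z\<^sub>0 \<in> D"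
  shows "norm (f (R *\<^sub>R z\<^sub>0)) < max_modulus D f R"
proof (rule ccontr)
  assume "\<not> norm (f (R *\<^sub>R z\<^sub>0)) < max_modulus D f R"
  then have max: "norm (f (R *\<^sub>R z)) \<le> norm (f (R *\<^sub>R z\<^sub>0))" if "z \<in> D" for z
    using norm_le_max_modulus[OF R that] by simp
  have line: "f (c *s w) = f (d *s w)"
    if top: "\<And>z. z \<in> D \<Longrightarrow> norm (f (R *\<^sub>R z)) \<le> norm (f (R *\<^sub>R (e *s w)))" and e: "e *s w \<in> D" for c d e w
  proof -
    let ?h = "\<lambda>c. f (c *s (R *\<^sub>R w))" and ?U = "{c. c *s w \<in> D}"
    have scale: "f (R *\<^sub>R (c *s w)) = ?h c" for c
      by (simp add: scaleR_eq_vector_scalar_mult vector_smult_assoc mult.commute)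
    have "continuous_on UNIV (\<lambda>c. c *s w)"
      by (intro linear_continuous_on linear_conv_bounded_linear[THEN iffD1] linearI)
        (simp_all add: vec_eq_iff algebra_simps)
    then have "open ?U"
      using open_domain by (simp add: continuous_on_open_vimage vimage_def)
    moreover have "norm (?h z) \<le> norm (?h e)" if "z \<in> ?U" for z
      using top[of "z *s w"] that by (simp only: scale mem_Collect_eq)
    ultimately have "?h constant_on UNIV"
      using e by (intro maximum_modulus_principle[of ?h UNIV ?U e])
        (auto intro!: entire_slice_holomorphic entire)
    then have "?h (c / R) = ?h (d / R)" by (metis constant_on_def UNIV_I)
    then show ?thesis
      using R by (simp add: scaleR_eq_vector_scalar_mult vector_smult_assoc)
  qed
  have "f (of_real R *s z\<^sub>0) = f (0 *s z\<^sub>0)"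
    by (rule line[of 1]) (use max z0 in auto)
  then have max0: "norm (f (R *\<^sub>R z)) \<le> norm (f 0)" if "z \<in> D" for z
    using max[OF that] by (simp add: scaleR_eq_vector_scalar_mult)
  have "f (1 *s z) = f (0 *s z)" for z
    by (rule line[of 0]) (use max0 zero_in_domain in auto)
  then show False using nonconstant by auto
qed

text \<open>
  A point \<open>w\<close> of \<open>D\<close> close to \<open>z\<close> dominates \<open>t *\<^sub>R z\<close> in every coordinate: the nonzero coordinates
  of \<open>z\<close> leave room for an approximation error, the others impose no condition.
\<close>

lemma closure_domain_contract:
  assumes z: "z \<in> closure D" and t: "0 \<le> t" "t < 1"
  shows "t *\<^sub>R z \<in> D"
proof -
  have "\<exists>w\<in>D. \<forall>j. t * norm (z $ j) \<le> norm (w $ j)"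
  proof (cases "z \<in> D")
    case True
    then show ?thesis using t by (intro bexI[of _ z]) (auto intro: mult_left_le_one_le)
  next
    case False
    have "\<forall>\<^sub>F w in at z within D. t * norm (z $ j) \<le> norm (w $ j)" for j
    proof (cases "z $ j = 0")
      case False
      have "((\<lambda>w. norm (w $ j)) \<longlongrightarrow> norm (z $ j)) (at z within D)"
        by (intro tendsto_intros)
      moreover have "t * norm (z $ j) < norm (z $ j)" using False t by simp
      ultimately show ?thesis
        by (auto dest!: order_tendstoD(1) elim: eventually_mono)
    qed simp
    then have "\<forall>\<^sub>F w in at z within D. (\<forall>j. t * norm (z $ j) \<le> norm (w $ j)) \<and> w \<in> D"
      by (intro eventually_conj eventually_all_finite) (auto simp: eventually_at_filter)
    moreover have "at z within D \<noteq> bot"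
      using z False by (simp add: closure_def trivial_limit_within)
    ultimately show ?thesis
      using eventually_happens' by blast
  qed
  then show ?thesis using t by (auto intro: domain_mono)
qed

text \<open>
  On the closure of \<open>D\<close> the supremum for radius \<open>R\<close> is attained, and after dilation by \<open>R < R'\<close>
  the maximum point is an interior point for radius \<open>R'\<close>.
\<close>

lemma max_modulus_strict_mono:
  assumes R: "0 < R" "R < R'"
  shows "max_modulus D f R < max_modulus D f R'"
proof -
  have "continuous_on (closure D) (\<lambda>z. norm (f (R *\<^sub>R z)))"
    by (intro continuous_intros continuous_on_compose2[OF entire_continuous_on[OF entire, of UNIV]]) auto
  moreover have "compact (closure D)" "closure D \<noteq> {}"
    using bounded_domain domain_nonempty by (auto simp: compact_closure)
  ultimately obtain z0 where z0: "z0 \<in> closure D"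
    "\<And>z. z \<in> closure D \<Longrightarrow> norm (f (R *\<^sub>R z)) \<le> norm (f (R *\<^sub>R z0))"
    by (meson continuous_attains_sup)
  have "max_modulus D f R \<le> norm (f (R *\<^sub>R z0))"
    using z0(2) closure_subset R by (intro max_modulus_le) auto
  also have "R *\<^sub>R z0 = R' *\<^sub>R ((R / R') *\<^sub>R z0)"
    using R by simp
  also have "norm (f \<dots>) < max_modulus D f R'"
    using R by (intro norm_less_max_modulus closure_domain_contract z0(1)) auto
  finally show ?thesis .
qed

lemma continuous_on_max_modulus: "continuous_on {0<..} (max_modulus D f)"
  unfolding continuous_on_iff
proof (intro ballI allI impI)
  fix R \<epsilon> :: real assume "R \<in> {0<..}" and \<epsilon>: "0 < \<epsilon>"
  then have R: "0 < R" by simp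
  obtain K where K: "0 < K" "\<And>z. z \<in> D \<Longrightarrow> norm z \<le> K"
    using bounded_domain by (meson bounded_pos)
  have "uniformly_continuous_on (cball 0 (2 * R * K)) f"
    by (intro compact_uniformly_continuous entire_continuous_on entire) auto
  then obtain \<delta> where \<delta>: "0 < \<delta>"
    "\<And>z w. z \<in> cball 0 (2 * R * K) \<Longrightarrow> w \<in> cball 0 (2 * R * K) \<Longrightarrow> dist w z < \<delta> \<Longrightarrow> dist (f w) (f z) < \<epsilon> / 2"
    using \<epsilon> unfolding uniformly_continuous_on_def by (metis half_gt_zero)
  have upper: "max_modulus D f s \<le> max_modulus D f t + \<epsilon> / 2"
    if st: "0 < s" "s \<le> 2 * R" "0 < t" "t \<le> 2 * R" "\<bar>s - t\<bar> < \<delta> / K" for s t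
  proof (rule max_modulus_le)
    fix z assume z: "z \<in> D"
    have "norm (s *\<^sub>R z) \<le> 2 * R * K" "norm (t *\<^sub>R z) \<le> 2 * R * K"
      using st R K z by (auto intro!: mult_mono)
    moreover have "dist (s *\<^sub>R z) (t *\<^sub>R z) < \<delta>"
    proof -
      have "dist (s *\<^sub>R z) (t *\<^sub>R z) = \<bar>s - t\<bar> * norm z"
        by (simp add: dist_norm flip: scaleR_diff_left)
      also have "\<dots> \<le> \<bar>s - t\<bar> * K" using K z by (intro mult_left_mono) auto
      also have "\<dots> < \<delta>" using st K by (simp add: pos_less_divide_eq)
      finally show ?thesis .
    qed
    ultimately have "dist (f (s *\<^sub>R z)) (f (t *\<^sub>R z)) < \<epsilon> / 2" by (intro \<delta>(2)) auto
    then have "norm (f (s *\<^sub>R z)) \<le> norm (f (t *\<^sub>R z)) + \<epsilon> / 2"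
      using norm_triangle_ineq2[of "f (s *\<^sub>R z)" "f (t *\<^sub>R z)"] by (simp add: dist_norm)
    then show "norm (f (s *\<^sub>R z)) \<le> max_modulus D f t + \<epsilon> / 2"
      using norm_le_max_modulus[OF st(3) z] by simp
  qed (use st in auto)
  show "\<exists>d>0. \<forall>R'\<in>{0<..}. dist R' R < d \<longrightarrow> dist (max_modulus D f R') (max_modulus D f R) < \<epsilon>"
  proof (intro exI conjI ballI impI)
    show "0 < min R (\<delta> / K)" using R \<delta> K by simp
    fix R' assume R': "R' \<in> {0<..}" "dist R' R < min R (\<delta> / K)"
    then have "R' \<le> 2 * R" "\<bar>R' - R\<bar> < \<delta> / K" by (auto simp: dist_real_def)
    with upper[of R R'] upper[of R' R] R R'
    show "dist (max_modulus D f R') (max_modulus D f R) < \<epsilon>"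
      using \<epsilon> by (auto simp: dist_real_def abs_minus_commute)
  qed
qed

lemma max_modulus_unbounded: "\<exists>R>0. B < max_modulus D f R"
proof (rule ccontr)
  assume "\<not> (\<exists>R>0. B < max_modulus D f R)"
  then have B: "\<And>R. 0 < R \<Longrightarrow> max_modulus D f R \<le> B" by (meson not_less)
  obtain e where e: "0 < e" "ball 0 e \<subseteq> D"
    using open_domain zero_in_domain by (meson open_contains_ball)
  have bound: "norm (f z) \<le> B" for z
  proof -
    define R where "R = (norm z + 1) / e"
    have R: "0 < R" using e by (simp add: R_def add_nonneg_pos)
    have "norm z < R * e" using e by (simp add: R_def)
    then have "z /\<^sub>R R \<in> D"
      using e(2) R by (intro subsetD[OF e(2)]) (simp add: field_simps)
    from norm_le_max_modulus[OF R this] B[OF R] R show ?thesis by simp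
  qed
  have "f z = f 0" for z
  proof -
    have "(\<lambda>c. f (c *s z)) constant_on UNIV"
      by (rule Liouville_theorem[OF entire_slice_holomorphic[OF entire]])
        (use bound in \<open>auto simp: bounded_iff\<close>)
    then have "f (1 *s z) = f (0 *s z)" by (metis constant_on_def UNIV_I)
    then show ?thesis by simp
  qed
  then show False using nonconstant by auto
qed

lemma max_modulus_mono: "0 < R \<Longrightarrow> R \<le> R' \<Longrightarrow> max_modulus D f R \<le> max_modulus D f R'"
  using max_modulus_strict_mono by (cases "R = R'") (auto intro: less_imp_le)

lemma inj_on_max_modulus: "inj_on (max_modulus D f) {0<..}"
  by (rule linorder_inj_onI) (use max_modulus_strict_mono in \<open>fastforce+\<close>)

lemma filterlim_max_modulus: "filterlim (max_modulus D f) at_top at_top"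
  unfolding filterlim_at_top
proof
  fix B
  obtain R where R: "0 < R" "B < max_modulus D f R" using max_modulus_unbounded by blast
  show "\<forall>\<^sub>F R' in at_top. B \<le> max_modulus D f R'"
    using eventually_ge_at_top[of R] by eventually_elim (use R max_modulus_mono in force)
qed

lemma max_modulus_inv_max_modulus:
  "0 < R \<Longrightarrow> max_modulus_inv D f (max_modulus D f R) = R"
  unfolding max_modulus_inv_def by (rule inv_into_f_f[OF inj_on_max_modulus]) simp

lemma large_in_range:
  assumes "max_modulus D f 1 \<le> y"
  shows "\<exists>R>0. max_modulus D f R = y"
proof -
  obtain R where R: "0 < R" "y < max_modulus D f R" using max_modulus_unbounded by blast
  have "1 \<le> R"
    using max_modulus_mono[of R 1] R assms by force
  then have "\<exists>x\<ge>1. x \<le> R \<and> max_modulus D f x = y"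
    using R assms by (intro IVT' continuous_on_subset[OF continuous_on_max_modulus]) auto
  then show ?thesis by (metis less_le_trans zero_less_one)
qed

lemma eventually_max_modulus_max_modulus_inv:
  "\<forall>\<^sub>F y in at_top. 0 < max_modulus_inv D f y \<and> max_modulus D f (max_modulus_inv D f y) = y"
  using eventually_ge_at_top[of "max_modulus D f 1"]
  by eventually_elim (use large_in_range max_modulus_inv_max_modulus in force)

lemma filterlim_max_modulus_inv: "filterlim (max_modulus_inv D f) at_top at_top"
  unfolding filterlim_at_top
proof
  fix C
  show "\<forall>\<^sub>F y in at_top. C \<le> max_modulus_inv D f y"
    using eventually_max_modulus_max_modulus_inv eventually_gt_at_top[of "max_modulus D f (max C 1)"]
  proof eventually_elim
    case (elim y)
    show ?case
    proof (rule ccontr)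
      assume "\<not> ?case"
      then have "max_modulus D f (max_modulus_inv D f y) \<le> max_modulus D f (max C 1)"
        using elim by (intro max_modulus_mono) auto
      then show False using elim by simp
    qed
  qed
qed

end

section \<open>Bounds for the relative type\<close>

text \<open>
  The map sending \<open>R\<close> to the radius at which \<open>g\<close> reaches the maximum modulus of \<open>f\<close> at \<open>R\<close> has
  its counterpart with \<open>f\<close> and \<open>g\<close> exchanged as an inverse near infinity. Every sequence of
  radii for \<open>g\<close> is therefore hit, which is what turns a limit inferior for \<open>g\<close> into one for
  the composition.
\<close>

lemma filtermap_max_modulus_change:
  fixes f g :: "complex ^ 'n \<Rightarrow> complex"
  assumes "nonconstant_entire_on_domain f D" "nonconstant_entire_on_domain g D"
  shows "filtermap (\<lambda>R. max_modulus_inv D g (max_modulus D f R)) at_top = at_top"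
proof -
  interpret f: nonconstant_entire_on_domain f D by fact
  interpret g: nonconstant_entire_on_domain g D by fact
  show ?thesis
  proof (rule filtermap_eq_of_right_inverse)
    show "filterlim (\<lambda>R. max_modulus_inv D g (max_modulus D f R)) at_top at_top"
      using f.filterlim_max_modulus g.filterlim_max_modulus_inv by (rule filterlim_compose[rotated])
    show "filterlim (\<lambda>r. max_modulus_inv D f (max_modulus D g r)) at_top at_top"
      using g.filterlim_max_modulus f.filterlim_max_modulus_inv by (rule filterlim_compose[rotated])
    show "\<forall>\<^sub>F r in at_top. max_modulus_inv D g (max_modulus D f (max_modulus_inv D f (max_modulus D g r))) = r"
      using eventually_compose_filterlim[OF f.eventually_max_modulus_max_modulus_inv g.filterlim_max_modulus]
        eventually_gt_at_top[of 0]
      by eventually_elim (simp add: g.max_modulus_inv_max_modulus)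
  qed
qed

lemma iter_log_Suc: "iter_log (Suc k) x = ln (iter_log k x)"
  by (simp add: iter_log_def)

lemma iter_log_eq_ln: "1 \<le> k \<Longrightarrow> iter_log k x = ln (iter_log (k - 1) x)"
  by (cases k) (simp_all add: iter_log_Suc)

lemma filterlim_iter_log: "filterlim (iter_log k) at_top at_top"
proof (induction k)
  case 0
  show ?case by (simp add: iter_log_def filterlim_ident id_def)
next
  case (Suc k)
  from filterlim_compose[OF ln_at_top this] show ?case by (simp add: iter_log_Suc[abs_def])
qed

lemma growth_comparison_max_modulus:
  fixes f g :: "complex ^ 'n \<Rightarrow> complex"
  assumes f: "nonconstant_entire_on_domain f D" and g: "nonconstant_entire_on_domain g D"
  shows "growth_comparison (\<lambda>R. iter_log i (max_modulus D f R)) (\<lambda>r. iter_log i (max_modulus D g r))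
    (iter_log j) (iter_log k) (\<lambda>R. max_modulus_inv D g (max_modulus D f R))"
proof
  interpret f: nonconstant_entire_on_domain f D by fact
  interpret g: nonconstant_entire_on_domain g D by fact
  show "filterlim (\<lambda>R. iter_log i (max_modulus D f R)) at_top at_top"
    by (rule filterlim_compose[OF filterlim_iter_log f.filterlim_max_modulus])
  show "filterlim (\<lambda>R. iter_log i (max_modulus D g R)) at_top at_top"
    by (rule filterlim_compose[OF filterlim_iter_log g.filterlim_max_modulus])
  show "filterlim (iter_log j) at_top at_top" "filterlim (iter_log k) at_top at_top"
    by (rule filterlim_iter_log)+
  show "filtermap (\<lambda>R. max_modulus_inv D g (max_modulus D f R)) at_top = at_top"
    by (rule filtermap_max_modulus_change[OF f g])
  show "\<forall>\<^sub>F R in at_top. iter_log i (max_modulus D g (max_modulus_inv D g (max_modulus D f R))) =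
      iter_log i (max_modulus D f R)"
    using eventually_compose_filterlim[OF g.eventually_max_modulus_max_modulus_inv f.filterlim_max_modulus]
    by eventually_elim simp
qed

lemma transcendental_entire_on_domain:
  "transcendental_entire f \<Longrightarrow> complete_circular_domain D \<Longrightarrow> nonconstant_entire_on_domain f D"
  by (simp add: nonconstant_entire_on_domain_def transcendental_entire_nonconstant)
    (simp add: transcendental_entire_def)

lemma has_index_pair_growth_order:
  assumes "has_index_pair D f m q"
  obtains \<rho> where "0 < \<rho>" "growth_order D f m q = ereal \<rho>"
proof -
  have "0 < growth_order D f m q \<and> growth_order D f m q < \<infinity>"
    using assms less_trans[of 0 1 "growth_order D f m q"]
    by (auto simp: has_index_pair_def split: if_splits)
  then show ?thesis by (cases "growth_order D f m q") (auto intro: that)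
qed

theorem theorem5:
  fixes f g :: "complex ^ 'n \<Rightarrow> complex"
    and D :: "(complex ^ 'n) set"
    and m p q :: nat
  assumes "transcendental_entire f" and "transcendental_entire g"
    and "complete_circular_domain D"
    and "1 \<le> q" and "q \<le> m" and "1 \<le> p" and "p \<le> m"
    and "has_index_pair D f m q" and "has_index_pair D g m p"
    and "0 < lower_growth_order D g m p"
  shows "max (epowr (lower_type D f m q / weak_type D g m p)
                (1 / real_of_ereal (lower_growth_order D g m p)))
             (epowr (upper_type D f m q / upper_weak_type D g m p)
                (1 / real_of_ereal (lower_growth_order D g m p)))
           \<le> relative_type D g f p q \<and>
         (determinate_quotient (upper_type D f m q) (lower_type D g m p) \<longrightarrow>
           relative_type D g f p q
             \<le> epowr (upper_type D f m q / lower_type D g m p)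
                (1 / real_of_ereal (growth_order D g m p)))"
proof -
  have m: "1 \<le> m" using assms(4,5) by simp
  obtain \<rho>f where \<rho>f: "0 < \<rho>f" "growth_order D f m q = ereal \<rho>f"
    using has_index_pair_growth_order[OF assms(8)] .
  obtain \<rho>g where \<rho>g: "0 < \<rho>g" "growth_order D g m p = ereal \<rho>g"
    using has_index_pair_growth_order[OF assms(9)] .
  have "lower_growth_order D g m p \<le> growth_order D g m p"
    unfolding lower_growth_order_def growth_order_def by (intro Liminf_le_Limsup) simp
  then obtain l where l: "0 < l" "lower_growth_order D g m p = ereal l"
    using assms(10) \<rho>g by (cases "lower_growth_order D g m p") auto
  interpret growth_comparison
    "\<lambda>R. iter_log (m - 1) (max_modulus D f R)" "\<lambda>r. iter_log (m - 1) (max_modulus D g r)"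
    "iter_log (q - 1)" "iter_log (p - 1)" "\<lambda>R. max_modulus_inv D g (max_modulus D f R)"
    using assms(1-3) by (intro growth_comparison_max_modulus transcendental_entire_on_domain)
  note log_eqs = iter_log_eq_ln[OF m] iter_log_eq_ln[OF assms(4)] iter_log_eq_ln[OF assms(6)]
  have order_bounds: "ereal (\<rho>f / \<rho>g) \<le> relative_order D g f p q"
    "relative_order D g f p q \<le> ereal (\<rho>f / l)"
    using relative_order_bounds[of \<rho>f \<rho>g l] \<rho>f \<rho>g l
    unfolding relative_order_def growth_order_def lower_growth_order_def log_eqs by auto
  then obtain \<rho> where \<rho>: "relative_order D g f p q = ereal \<rho>"
    by (cases "relative_order D g f p q") auto
  have le: "\<rho>f / \<rho>g \<le> \<rho>" "\<rho> \<le> \<rho>f / l"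
    using order_bounds \<rho> by auto
  \<comment> \<open>The bounds below are for the exponents \<open>\<rho>f / l\<close> and \<open>\<rho>f / \<rho>g\<close>; the exponent \<open>\<rho>\<close> in the
    relative type lies between them, and a smaller exponent gives a larger type.\<close>
  note lower = relative_type_bounds(2,3)[OF l(1), of \<rho>f, THEN order_trans, OF type_antimono[OF le(2)]]
  note upper = order_trans[OF type_antimono[OF le(1)] relative_type_bounds(1)[OF \<rho>g(1), of \<rho>f]]
  show ?thesis
    using lower upper
    by (simp add: upper_type_def lower_type_def weak_type_def upper_weak_type_def relative_type_def
        \<rho>f(2) \<rho>g(2) l(2) \<rho>)
qed

end
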